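(* Let $n\geq 3$ and $k\geq 3$ be odd integers, and let $G$ be a connected graph of order $n$. (1) If ($n\geq 7$ or $n=3$) and $e(G)\geq \binom{n-1}{2}+1$, then $G$ is $\mathrm{GFC}_k$ unless $G = K_1 \vee (K_{n-2}+K_1)$. (2) If $n=5$ and $e(G)\geq 7$, then $G$ is $\mathrm{GFC}_k$ unless $G = K_1 \vee (K_3+K_1)$ or $G = K_2 \vee 3K_1$.
   Context: All graphs are finite, simple and undirected. The order of $G$ is its number of vertices and $e(G)$ is its number of edges. $K_m$ is the complete graph on $m$ vertices, $G_1+G_2$ is the (vertex-disjoint) union, $mK_1$ is the graph consisting of $m$ isolated vertices, and the join $G_1\vee G_2$ is obtained from vertex-disjoint $G_1,G_2$ by adding all edges between $V(G_1)$ and $V(G_2)$. Equality of graphs means isomorphism. For a graph $H$, let $\mathrm{odd}(H)$ be the number of nontrivial odd components of $H$ (connected components with an odd number, at least $3$, of vertices) and $i(H)$ the number of isolated vertices of $H$. For odd $k$ define $$\mathrm{def}_k(G)=\max_{S\subseteq V(G)}\{\mathrm{odd}(G-S)+k\cdot i(G-S)-k|S|\}.$$ A $k$-barrier of $G$ is a subset $S\subseteq V(G)$ attaining this maximum. A graph $G$ of odd order is generalized factor-critical, written $\mathrm{GFC}_k$, if $\emptyset$ is its only $k$-barrier. *)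

theory Defs
  imports Main
begin

text \<open>Finite simple undirected graphs: a vertex set and a set of two-element subsets of it.\<close>

datatype 'a ugraph = UGraph (verts: "'a set") (edges: "'a set set")

definition simple_graph :: "'a ugraph \<Rightarrow> bool" where
  "simple_graph G \<longleftrightarrow>
     finite (verts G) \<and> (\<forall>e \<in> edges G. e \<subseteq> verts G \<and> card e = 2)"

definition order :: "'a ugraph \<Rightarrow> nat" where
  "order G = card (verts G)"

definition size_e :: "'a ugraph \<Rightarrow> nat" where
  "size_e G = card (edges G)"

definition graph_iso :: "'a ugraph \<Rightarrow> 'b ugraph \<Rightarrow> bool" (infix \<open>\<simeq>\<close> 50) where
  "G \<simeq> H \<longleftrightarrow> (\<exists>f. bij_betw f (verts G) (verts H) \<and>
     (\<forall>u \<in> verts G. \<forall>v \<in> verts G. {u, v} \<in> edges G \<longleftrightarrow> {f u, f v} \<in> edges H))"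

definition complete_graph :: "nat \<Rightarrow> nat ugraph" where
  "complete_graph m = UGraph {..<m} {e. e \<subseteq> {..<m} \<and> card e = 2}"

definition isolated_graph :: "nat \<Rightarrow> nat ugraph" where
  "isolated_graph m = UGraph {..<m} {}"

text \<open>The sum type makes the operands of union and join vertex-disjoint.\<close>

definition graph_union :: "'a ugraph \<Rightarrow> 'b ugraph \<Rightarrow> ('a + 'b) ugraph" where
  "graph_union G H =
     UGraph (verts G <+> verts H) ((`) Inl ` edges G \<union> (`) Inr ` edges H)"

definition graph_join :: "'a ugraph \<Rightarrow> 'b ugraph \<Rightarrow> ('a + 'b) ugraph" where
  "graph_join G H =
     UGraph (verts G <+> verts H)
       (edges (graph_union G H) \<union> {{Inl u, Inr v} | u v. u \<in> verts G \<and> v \<in> verts H})"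

definition delete_verts :: "'a ugraph \<Rightarrow> 'a set \<Rightarrow> 'a ugraph" where
  "delete_verts G S = UGraph (verts G - S) {e \<in> edges G. e \<inter> S = {}}"

definition reachable :: "'a ugraph \<Rightarrow> ('a \<times> 'a) set" where
  "reachable G = {(u, v). {u, v} \<in> edges G}\<^sup>* \<inter> verts G \<times> verts G"

text \<open>Components are represented by their vertex sets.\<close>

definition components :: "'a ugraph \<Rightarrow> 'a set set" where
  "components G = verts G // reachable G"

definition connected_graph :: "'a ugraph \<Rightarrow> bool" where
  "connected_graph G \<longleftrightarrow>
     verts G \<noteq> {} \<and> (\<forall>u \<in> verts G. \<forall>v \<in> verts G. (u, v) \<in> reachable G)"

definition odd_comps :: "'a ugraph \<Rightarrow> nat" where
  "odd_comps H = card {C \<in> components H. odd (card C) \<and> card C \<ge> 3}"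

definition isolated_count :: "'a ugraph \<Rightarrow> nat" where
  "isolated_count H = card {v \<in> verts H. \<forall>e \<in> edges H. v \<notin> e}"

definition deficit :: "nat \<Rightarrow> 'a ugraph \<Rightarrow> 'a set \<Rightarrow> int" where
  "deficit k G S = int (odd_comps (delete_verts G S))
     + int k * int (isolated_count (delete_verts G S)) - int k * int (card S)"

definition def_k :: "nat \<Rightarrow> 'a ugraph \<Rightarrow> int" where
  "def_k k G = Max {deficit k G S | S. S \<subseteq> verts G}"

definition k_barrier :: "nat \<Rightarrow> 'a ugraph \<Rightarrow> 'a set \<Rightarrow> bool" where
  "k_barrier k G S \<longleftrightarrow> S \<subseteq> verts G \<and> deficit k G S = def_k k G"

definition GFC :: "nat \<Rightarrow> 'a ugraph \<Rightarrow> bool" where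
  "GFC k G \<longleftrightarrow> odd (order G) \<and> (\<forall>S. k_barrier k G S \<longleftrightarrow> S = {})"

end

theory Submission
  imports Defs
begin

text \<open>If \<open>G\<close> is not generalized factor-critical, some nonempty \<open>S\<close> has positive deficit.
  Let \<open>s = |S|\<close>, and let \<open>G - S\<close> have \<open>i\<close> isolated vertices, \<open>r\<close> other vertices and \<open>q\<close>
  nontrivial odd components, so that \<open>q + k i > k s\<close>.  The edge condition says that \<open>G\<close> has at most
  \<open>n - 2 = s + i + r - 2\<close> non-edges, whereas the isolated vertices force at least \<open>i(i-1)/2 + i r\<close>
  of them, and two odd components force a further \<open>3(r - 3)\<close>.  These bounds are only compatible
  for \<open>(i, s) = (1, 1)\<close> and for \<open>r = 0\<close>, \<open>(i, s) \<in> {(2, 1), (3, 2)}\<close>; then the non-edges are exactly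
  the pairs meeting the isolated vertices, which determines \<open>G\<close>.\<close>

section \<open>Unions, joins and isomorphism\<close>

lemma complete_graph_simps [simp]:
  "verts (complete_graph m) = {..<m}"
  "{a, b} \<in> edges (complete_graph m) \<longleftrightarrow> a < m \<and> b < m \<and> a \<noteq> b"
  by (auto simp: complete_graph_def card_2_iff doubleton_eq_iff)

lemma isolated_graph_simps [simp]:
  "verts (isolated_graph m) = {..<m}" "edges (isolated_graph m) = {}"
  by (simp_all add: isolated_graph_def)

text \<open>Injectivity of \<open>Inl\<close> carries over to the map taking a set to its image
  under \<open>Inl\<close>; an image under \<open>Inr\<close> never contains
  \<open>Inl a\<close>.\<close>

lemma Inl_pair_in_images:
  "{Inl a, Inl b} \<in> (`) Inl ` A \<union> (`) Inr ` B \<longleftrightarrow> {a, b} \<in> A"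
proof -
  have "{Inl a, Inl b} \<in> (`) Inl ` A \<longleftrightarrow> {a, b} \<in> A"
    using inj_image_mem_iff[OF inj_on_image[of Inl "UNIV"], of "{a, b}" A]
    by (force simp: image_iff)
  moreover have "{Inl a, Inl b} \<notin> (`) Inr ` B"
    by (auto dest: equalityD1)
  ultimately show ?thesis by blast
qed

lemma Inr_pair_in_images:
  "{Inr a, Inr b} \<in> (`) Inl ` A \<union> (`) Inr ` B \<longleftrightarrow> {a, b} \<in> B"
proof -
  have "{Inr a, Inr b} \<in> (`) Inr ` B \<longleftrightarrow> {a, b} \<in> B"
    using inj_image_mem_iff[OF inj_on_image[of Inr "UNIV"], of "{a, b}" B]
    by (force simp: image_iff)
  moreover have "{Inr a, Inr b} \<notin> (`) Inl ` A"
    by (auto dest: equalityD1)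
  ultimately show ?thesis by blast
qed

lemma mixed_pair_notin_images:
  "{Inl a, Inr b} \<notin> (`) Inl ` A \<union> (`) Inr ` B"
  by (auto dest: equalityD1)

lemma graph_union_simps [simp]:
  "verts (graph_union G H) = verts G <+> verts H"
  "{Inl a, Inl b} \<in> edges (graph_union G H) \<longleftrightarrow> {a, b} \<in> edges G"
  "{Inr c, Inr d} \<in> edges (graph_union G H) \<longleftrightarrow> {c, d} \<in> edges H"
  "{Inl a, Inr d} \<notin> edges (graph_union G H)"
  "{Inr d, Inl a} \<notin> edges (graph_union G H)"
  using Inl_pair_in_images[of a b "edges G" "edges H"]
    Inr_pair_in_images[of c d "edges G" "edges H"]
    mixed_pair_notin_images[of a d "edges G" "edges H"]
  by (simp_all add: graph_union_def insert_commute)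

lemma graph_join_simps [simp]:
  "verts (graph_join G H) = verts G <+> verts H"
  "{Inl a, Inl b} \<in> edges (graph_join G H) \<longleftrightarrow> {a, b} \<in> edges G"
  "{Inr c, Inr d} \<in> edges (graph_join G H) \<longleftrightarrow> {c, d} \<in> edges H"
  "{Inl a, Inr d} \<in> edges (graph_join G H) \<longleftrightarrow> a \<in> verts G \<and> d \<in> verts H"
  "{Inr d, Inl a} \<in> edges (graph_join G H) \<longleftrightarrow> a \<in> verts G \<and> d \<in> verts H"
  by (auto simp: graph_join_def doubleton_eq_iff insert_commute)

text \<open>When the two endpoints coincide, the simplifier collapses the pair to a singleton and
  the pair rules no longer match. These instances cover that case in the isomorphism proofs.\<close>

lemma singleton_edge_simps [simp]:
  "{a} \<notin> edges (complete_graph m)"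
  "{Inl u} \<in> edges (graph_union G H) \<longleftrightarrow> {u} \<in> edges G"
  "{Inr v} \<in> edges (graph_union G H) \<longleftrightarrow> {v} \<in> edges H"
  "{Inl u} \<in> edges (graph_join G H) \<longleftrightarrow> {u} \<in> edges G"
  "{Inr v} \<in> edges (graph_join G H) \<longleftrightarrow> {v} \<in> edges H"
  using complete_graph_simps(2)[of a a m] graph_union_simps(2)[of u u G H]
    graph_union_simps(3)[of v v G H] graph_join_simps(2)[of u u G H] graph_join_simps(3)[of v v G H]
  by simp_all

text \<open>Separate enumerations of \<open>S\<close> (the clique) and of its complement (the
  independent set) are glued along the sum type. The case \<open>a = 2\<close>, \<open>b = 3\<close>
  recognises the exception of order 5.\<close>

lemma graph_iso_join_isolated:
  assumes fin: "finite (verts G)" and S: "S \<subseteq> verts G" "card S = a" "card (verts G - S) = b"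
    and E: "\<And>u w. u \<in> verts G \<Longrightarrow> w \<in> verts G \<Longrightarrow>
      {u, w} \<in> edges G \<longleftrightarrow> u \<noteq> w \<and> (u \<in> S \<or> w \<in> S)"
  shows "G \<simeq> graph_join (complete_graph a) (isolated_graph b)"
proof -
  obtain g where g: "bij_betw g S {..<a}"
    using ex_bij_betw_finite_nat[of S] fin S finite_subset by (metis lessThan_atLeast0)
  obtain h where h: "bij_betw h (verts G - S) {..<b}"
    using ex_bij_betw_finite_nat[of "verts G - S"] fin S by (metis finite_Diff lessThan_atLeast0)
  define f where "f u = (if u \<in> S then Inl (g u) else Inr (h u))" for u
  have gi: "g u = g w \<longleftrightarrow> u = w" if "u \<in> S" "w \<in> S" for u w
    using g that by (auto simp: bij_betw_def inj_on_def)
  have gr: "g u < a" if "u \<in> S" for u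
    using g that by (auto simp: bij_betw_def)
  have hi: "h u = h w \<longleftrightarrow> u = w" if "u \<in> verts G - S" "w \<in> verts G - S" for u w
    using h that unfolding bij_betw_def inj_on_def by blast
  have hr: "h u < b" if "u \<in> verts G - S" for u
    using h that by (auto simp: bij_betw_def)
  have "f ` verts G = f ` S \<union> f ` (verts G - S)" using S(1) by blast
  also have "\<dots> = Inl ` g ` S \<union> Inr ` h ` (verts G - S)"
    by (simp add: f_def image_image)
  also have "\<dots> = {..<a} <+> {..<b}"
    using g h by (simp add: bij_betw_def Plus_def)
  finally have "bij_betw f (verts G) ({..<a} <+> {..<b})"
    using gi hi by (auto simp: bij_betw_def inj_on_def f_def)
  moreover have "{u, w} \<in> edges G \<longleftrightarrow>
      {f u, f w} \<in> edges (graph_join (complete_graph a) (isolated_graph b))"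
    if "u \<in> verts G" "w \<in> verts G" for u w
    using that gi gr hr by (auto simp: E f_def)
  ultimately show ?thesis unfolding graph_iso_def by auto
qed

text \<open>Here \<open>x\<close> is adjacent to everything, \<open>v\<close> has \<open>x\<close>
  as its only neighbour, and the remaining \<open>n - 2\<close> vertices form a clique. So
  \<open>x\<close> is sent to the left factor of the join and \<open>v\<close> to the single vertex
  on the right.\<close>

lemma graph_iso_join_pendant:
  fixes G :: "'a ugraph"
  assumes fin: "finite (verts G)" and n: "card (verts G) = n"
    and xv: "x \<in> verts G" "v \<in> verts G" "x \<noteq> v"
    and E: "\<And>u w. u \<in> verts G \<Longrightarrow> w \<in> verts G \<Longrightarrow>
      {u, w} \<in> edges G \<longleftrightarrow> u \<noteq> w \<and> (u = x \<or> w = x \<or> (u \<noteq> v \<and> w \<noteq> v))"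
  shows "G \<simeq> graph_join (complete_graph 1) (graph_union (complete_graph (n - 2)) (complete_graph 1))"
proof -
  define Q where "Q = verts G - {x, v}"
  have "finite Q" "card Q = n - 2"
    using fin n xv unfolding Q_def by (auto simp: card_Diff_subset)
  then obtain g where g: "bij_betw g Q {..<n - 2}"
    using ex_bij_betw_finite_nat[of Q] by (metis lessThan_atLeast0)
  define f :: "'a \<Rightarrow> nat + nat + nat" where
    "f u = (if u = x then Inl 0 else if u = v then Inr (Inr 0) else Inr (Inl (g u)))" for u
  have gi: "g u = g w \<longleftrightarrow> u = w" if "u \<in> Q" "w \<in> Q" for u w
    using g that by (auto simp: bij_betw_def inj_on_def)
  have gr: "g u < n - 2" if "u \<in> Q" for u
    using g that by (auto simp: bij_betw_def)
  have V: "u \<in> verts G \<longleftrightarrow> u = x \<or> u = v \<or> u \<in> Q" for u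
    using xv unfolding Q_def by blast
  have xQ: "x \<notin> Q" "v \<notin> Q" unfolding Q_def by auto
  have "f ` verts G = {f x, f v} \<union> f ` Q"
    using V by auto
  also have "f ` Q = (\<lambda>u. Inr (Inl (g u))) ` Q"
    using xQ by (intro image_cong) (auto simp: f_def)
  also have "\<dots> = Inr ` Inl ` g ` Q" by (simp add: image_image)
  also have "{f x, f v} \<union> \<dots> = {..<1} <+> ({..<n - 2} <+> {..<1})"
    using g xv by (auto simp: bij_betw_def Plus_def f_def)
  finally have "bij_betw f (verts G) ({..<1} <+> ({..<n - 2} <+> {..<1}))"
    using gi V xQ by (auto simp: bij_betw_def inj_on_def f_def)
  moreover have "{u, w} \<in> edges G \<longleftrightarrow> {f u, f w} \<in> edges (graph_join (complete_graph 1)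
      (graph_union (complete_graph (n - 2)) (complete_graph 1)))"
    if "u \<in> verts G" "w \<in> verts G" for u w
    using that gi gr xv xQ unfolding E[OF that] V by (auto simp: f_def)
  ultimately show ?thesis unfolding graph_iso_def by auto
qed

section \<open>Components\<close>

lemma sym_adjacency: "sym {(u, v). {u, v} \<in> E}"
  by (auto simp: sym_def insert_commute)

lemma equiv_reachable: "equiv (verts G) (reachable G)"
proof (rule equivI)
  show "refl_on (verts G) (reachable G)"
    by (auto simp: refl_on_def reachable_def)
  show "sym (reachable G)"
    using sym_rtrancl[OF sym_adjacency[of "edges G"]] by (auto simp: sym_def reachable_def)
  show "trans (reachable G)"
    by (auto simp: trans_def reachable_def intro: rtrancl_trans)
qed (auto simp: reachable_def)

lemma component_subset: "C \<in> components G \<Longrightarrow> C \<subseteq> verts G"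
  unfolding components_def by (metis equiv_reachable Union_quotient Union_upper)

lemma components_disjoint:
  "\<lbrakk>C \<in> components G; D \<in> components G; C \<noteq> D\<rbrakk> \<Longrightarrow> C \<inter> D = {}"
  unfolding components_def using quotient_disj[OF equiv_reachable] by blast

lemma component_closed:
  assumes "C \<in> components G" "u \<in> C" "v \<in> verts G" "{u, v} \<in> edges G"
  shows "v \<in> C"
proof -
  have "(u, v) \<in> reachable G"
    using assms component_subset unfolding reachable_def by auto
  then show ?thesis
    using assms(1,2) in_quotient_imp_closed[OF equiv_reachable] unfolding components_def by metis
qed

text \<open>A path from \<open>v\<close> to a second vertex of its component starts with an edge at
  \<open>v\<close>.\<close>

lemma component_nonisolated:
  assumes C: "C \<in> components G" "card C \<ge> 2" "v \<in> C"
  shows "\<exists>e \<in> edges G. v \<in> e"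
proof -
  obtain u where u: "u \<in> C" "u \<noteq> v"
  proof -
    have "\<not> C \<subseteq> {v}" using C(2) card_mono[of "{v}" C] by auto
    then show thesis using that by blast
  qed
  have "(v, u) \<in> reachable G"
    using C u quotient_eq_iff[OF equiv_reachable] unfolding components_def by metis
  then have "(v, u) \<in> {(u, v). {u, v} \<in> edges G}\<^sup>*"
    by (auto simp: reachable_def)
  then show ?thesis
    using u by (cases rule: converse_rtranclE) auto
qed

section \<open>Deficits and barriers\<close>

text \<open>The only component is the whole vertex set, which counts as one nontrivial odd component
  and leaves no isolated vertex. This is the value that a competing barrier has to reach.\<close>

lemma deficit_empty:
  assumes conn: "connected_graph G" and n: "odd (card (verts G))" "card (verts G) \<ge> 3"
  shows "deficit k G {} = 1"
proof -
  have del: "delete_verts G {} = G" by (cases G) (simp add: delete_verts_def)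
  have "reachable G `` {v} = verts G" if "v \<in> verts G" for v
    using conn that unfolding connected_graph_def reachable_def by auto
  moreover have "verts G \<noteq> {}" using conn by (simp add: connected_graph_def)
  ultimately have comps: "components G = {verts G}"
    unfolding components_def quotient_def by auto
  have "\<exists>e \<in> edges G. v \<in> e" if "v \<in> verts G" for v
    using component_nonisolated[of "verts G" G v] comps that n by simp
  then have "{v \<in> verts G. \<forall>e \<in> edges G. v \<notin> e} = {}" by blast
  moreover have "{C \<in> components G. odd (card C) \<and> card C \<ge> 3} = {verts G}"
    using comps n by auto
  ultimately show ?thesis
    by (simp only: deficit_def del odd_comps_def isolated_count_def) simp
qed

text \<open>If every nonempty \<open>S\<close> had deficit below 1, the maximum would be 1 and
  attained only at the empty set.\<close>

lemma positive_deficit_if_not_GFC: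
  assumes fin: "finite (verts G)" and odd: "odd (order G)"
    and empty: "deficit k G {} = 1" and not: "\<not> GFC k G"
  shows "\<exists>S \<subseteq> verts G. S \<noteq> {} \<and> deficit k G S \<ge> 1"
proof (rule ccontr)
  assume "\<not> ?thesis"
  then have neg: "deficit k G S < 1" if "S \<subseteq> verts G" "S \<noteq> {}" for S
    using that by (meson not_le)
  have "{deficit k G S | S. S \<subseteq> verts G} = deficit k G ` Pow (verts G)" by auto
  then have "finite {deficit k G S | S. S \<subseteq> verts G}" using fin by simp
  then have "def_k k G = 1"
    unfolding def_k_def
  proof (rule Max_eqI)
    fix y assume "y \<in> {deficit k G S | S. S \<subseteq> verts G}"
    then obtain S where "S \<subseteq> verts G" "y = deficit k G S" by blast
    then show "y \<le> 1" using neg[of S] empty by (cases "S = {}") auto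
  next
    have "{} \<subseteq> verts G" by simp
    then show "1 \<in> {deficit k G S | S. S \<subseteq> verts G}" using empty by force
  qed
  then have "k_barrier k G S \<longleftrightarrow> S = {}" for S
    unfolding k_barrier_def using neg[of S] empty by (cases "S = {}") auto
  then show False using not odd unfolding GFC_def by blast
qed

section \<open>Counting non-edges\<close>

definition non_edges :: "'a ugraph \<Rightarrow> 'a set set" where
  "non_edges G = {e. e \<subseteq> verts G \<and> card e = 2} - edges G"

lemma finite_non_edges: "finite (verts G) \<Longrightarrow> finite (non_edges G)"
  unfolding non_edges_def by (rule finite_subset[of _ "Pow (verts G)"]) auto

lemma card_non_edges:
  assumes "simple_graph G"
  shows "card (non_edges G) + size_e G = order G choose 2"
proof -
  have fin: "finite (verts G)" and sub: "edges G \<subseteq> {e. e \<subseteq> verts G \<and> card e = 2}"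
    using assms unfolding simple_graph_def by auto
  have "finite {e. e \<subseteq> verts G \<and> card e = 2}" using fin by simp
  then have "card (non_edges G) = card {e. e \<subseteq> verts G \<and> card e = 2} - size_e G"
    "size_e G \<le> card {e. e \<subseteq> verts G \<and> card e = 2}"
    unfolding non_edges_def size_e_def using sub
    by (auto intro: card_Diff_subset card_mono finite_subset)
  then show ?thesis using n_subsets[OF fin, of 2] by (simp add: order_def)
qed

lemma choose_two_mult: "2 * (n choose 2) = n * (n - 1)" for n :: nat
  by (cases n) (simp_all add: choose_two)

lemma choose_two_add: "(a + b) choose 2 = (a choose 2) + a * b + (b choose 2)"
  by (induction a) (auto simp: numeral_2_eq_2)

text \<open>Remove from all pairs in \<open>W\<close> those lying in \<open>W - I\<close>, then
  split \<open>card W choose 2\<close> by \<open>choose_two_add\<close>.\<close>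

lemma card_pairs_meeting:
  assumes "finite W" "I \<subseteq> W"
  shows "card {e. e \<subseteq> W \<and> card e = 2 \<and> e \<inter> I \<noteq> {}} = (card I choose 2) + card I * card (W - I)"
proof -
  have finI: "finite I" using assms finite_subset by auto
  have "{e. e \<subseteq> W \<and> card e = 2 \<and> e \<inter> I \<noteq> {}} =
      {e. e \<subseteq> W \<and> card e = 2} - {e. e \<subseteq> W - I \<and> card e = 2}" by auto
  also have "card \<dots> = (card W choose 2) - (card (W - I) choose 2)"
    using assms by (subst card_Diff_subset) (auto simp: n_subsets)
  also have "card W = card I + card (W - I)"
    using assms finI by (metis card_Un_disjoint Diff_disjoint Un_Diff_cancel finite_Diff Un_absorb1)
  finally show ?thesis by (simp add: choose_two_add)
qed

lemma card_cross_pairs: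
  assumes "finite A" "finite B" "A \<inter> B = {}"
  shows "card {{u, v} | u v. u \<in> A \<and> v \<in> B} = card A * card B"
proof -
  have "{{u, v} | u v. u \<in> A \<and> v \<in> B} = (\<lambda>(u, v). {u, v}) ` (A \<times> B)" by auto
  moreover have "inj_on (\<lambda>(u, v). {u, v}) (A \<times> B)"
    using assms(3) by (auto simp: inj_on_def doubleton_eq_iff)
  ultimately show ?thesis by (simp add: card_image card_cartesian_product)
qed

text \<open>The difference of the two sides is \<open>(c - 3) * (d - 3)\<close>. It bounds the
  number of pairs between an odd component and the other non-isolated vertices.\<close>

lemma rectangle_ge:
  fixes c d :: nat
  assumes "c \<ge> 3" "d \<ge> 3"
  shows "3 * (c + d - 3) \<le> c * d"
proof -
  obtain c' d' where "c = c' + 3" "d = d' + 3"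
    using assms by (metis le_add_diff_inverse2)
  then show ?thesis by (simp add: algebra_simps)
qed

section \<open>The arithmetic of the counts\<close>

text \<open>\<open>M\<close> stands for the number of non-edges. Working with \<open>2 * M\<close>
  over the integers makes all bounds polynomial. For \<open>i > s\<close> the non-edges at isolated
  vertices are nearly too many already; for \<open>i \<le> s\<close> the deficit forces
  \<open>q \<ge> 3 * (s - i) + 1\<close>, hence a large \<open>r\<close>.\<close>

lemma deficit_arith:
  fixes i r s q k M :: int
  assumes nonneg: "i \<ge> 0" "r \<ge> 0" "s \<ge> 1" "q \<ge> 0" "k \<ge> 3"
    and deficit: "q + k * i - k * s \<ge> 1"
    and upper: "M \<le> i + r + s - 2"
    and lower: "2 * M \<ge> i * (i - 1) + 2 * (i * r)"
    and room: "r \<ge> 3 * q"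
    and lower': "q \<ge> 2 \<Longrightarrow> 2 * M \<ge> i * (i - 1) + 2 * (i * r) + 6 * (r - 3)"
  shows "2 * M = i * (i - 1) + 2 * (i * r) \<and>
    (i = 1 \<and> s = 1 \<or> r = 0 \<and> i = 2 \<and> s = 1 \<or> r = 0 \<and> i = 3 \<and> s = 2)"
proof (cases "i \<ge> s + 1")
  case True
  \<comment> \<open>In this case both terms on the left are nonnegative and the right side is at
    most 0, so all three vanish.\<close>
  have "(i - 2) * (i - 3) + 2 * (r * (i - 1)) \<le> 2 * (s + 1 - i)"
    using upper lower by (simp add: algebra_simps)
  moreover have p: "(i - 2) * (i - 3) \<ge> 0"
  proof (cases "i \<ge> 3")
    case False
    then have "i = 2" using True nonneg by linarith
    then show ?thesis by simp
  qed simp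
  moreover have "r * (i - 1) \<ge> r"
    using mult_left_mono[of 1 "i - 1" r] True nonneg by simp
  ultimately have "r \<le> 0" "s \<ge> i - 1" "(i - 2) * (i - 3) \<le> 0"
    using True nonneg by (smt (verit))+
  then have *: "r = 0" "s = i - 1" "(i - 2) * (i - 3) = 0"
    using True nonneg p by (intro order_antisym; simp)+
  then have "i = 2 \<or> i = 3" by simp
  then show ?thesis using * upper lower by auto
next
  case False
  define d where "d = s - i"
  have d: "d \<ge> 0" "s = i + d" using False by (auto simp: d_def)
  have "k * d \<ge> 3 * d" using d nonneg by (simp add: mult_right_mono)
  then have q: "q \<ge> 3 * d + 1" using deficit d by (simp add: algebra_simps)
  have ii: "i * (i - 1) \<ge> 0" using nonneg by (cases "i = 0") auto
  show ?thesis
  proof (cases "d = 0")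
    case True
    have "i * (i - 1) + 2 * (i * r) \<le> 2 * (i + r + i - 2)"
      using upper lower d True by (smt (verit))
    \<comment> \<open>Now \<open>q \<ge> 1\<close> gives \<open>r \<ge> 3\<close>, so the second
      factor is positive and \<open>i = s = 1\<close> remains.\<close>
    then have "(i - 1) * (i + 2 * r - 4) \<le> 0" by (simp add: algebra_simps)
    moreover have "i + 2 * r - 4 > 0" using room q True d nonneg by linarith
    ultimately have "i = 1" using nonneg d True by (simp add: mult_le_0_iff)
    then show ?thesis using d True upper lower by auto
  next
    case False
    \<comment> \<open>This absorbs the \<open>4 * i\<close> in the doubled upper bound
      \<open>2 * (2 * i + r + d - 2)\<close>. Since \<open>q \<ge> 4\<close> makes
      \<open>lower'\<close> available, \<open>4 * r \<le> 2 * d + 14\<close> follows, contrary to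
      \<open>r \<ge> 9 * d + 3\<close>.\<close>
    have "i * r \<ge> i * 2" using room q d nonneg by (intro mult_left_mono) linarith+
    moreover have "2 * M \<ge> i * (i - 1) + 2 * (i * r) + 6 * (r - 3)"
      using lower' q d False by simp
    ultimately have False using upper room q d False ii by (smt (verit))
    then show ?thesis ..
  qed
qed

text \<open>The witness \<open>I\<close> is the set of isolated vertices of \<open>G - S\<close>.
  Pairs outside \<open>S\<close> that meet \<open>I\<close> are non-edges, and the arithmetic shows
  that their number already equals that of all non-edges.\<close>

lemma positive_deficit_structure:
  assumes G: "simple_graph G" and S: "S \<subseteq> verts G" "S \<noteq> {}"
    and k: "k \<ge> 3" and deficit: "deficit k G S \<ge> 1"
    and few: "card (non_edges G) + 2 \<le> card (verts G)"
  obtains I where "I \<subseteq> verts G - S"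
    "non_edges G = {e. e \<subseteq> verts G - S \<and> card e = 2 \<and> e \<inter> I \<noteq> {}}"
    "card I = 1 \<and> card S = 1 \<or>
     I = verts G - S \<and> (card I = 2 \<and> card S = 1 \<or> card I = 3 \<and> card S = 2)"
proof -
  define W H where "W = verts G - S" and "H = delete_verts G S"
  \<comment> \<open>The cardinalities of \<open>I\<close>, \<open>R\<close>, \<open>S\<close> and
    \<open>Q\<close> are the parameters \<open>i\<close>, \<open>r\<close>, \<open>s\<close> and
    \<open>q\<close> of \<open>deficit_arith\<close>; \<open>A\<close> collects the non-edges forced
    by \<open>I\<close>.\<close>
  define I R where "I = {v \<in> verts H. \<forall>e \<in> edges H. v \<notin> e}" and "R = W - I"
  define Q where "Q = {C \<in> components H. odd (card C) \<and> card C \<ge> 3}"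
  define A where "A = {e. e \<subseteq> W \<and> card e = 2 \<and> e \<inter> I \<noteq> {}}"
  have fin: "finite (verts G)" and finW: "finite W" and finR: "finite R"
    using G by (auto simp: simple_graph_def W_def R_def)
  have VH: "verts H = W" and EH: "\<And>e. e \<in> edges H \<longleftrightarrow> e \<in> edges G \<and> e \<inter> S = {}"
    by (auto simp: H_def W_def delete_verts_def)
  have IW: "I \<subseteq> W" by (auto simp: I_def VH)
  have A_sub: "A \<subseteq> non_edges G"
  proof
    fix e assume e: "e \<in> A"
    then have "e \<notin> edges H" by (auto simp: A_def I_def)
    then show "e \<in> non_edges G" using e unfolding EH A_def W_def non_edges_def by blast
  qed
  have card_A: "card A = (card I choose 2) + card I * card R"
    unfolding A_def R_def using card_pairs_meeting[OF finW IW] .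
  have A2: "2 * int (card A) = int (card I) * (int (card I) - 1) + 2 * (int (card I) * int (card R))"
  proof -
    have "2 * int (card I choose 2) = int (card I * (card I - 1))"
      unfolding choose_two_mult[symmetric] by simp
    also have "\<dots> = int (card I) * (int (card I) - 1)"
      by (cases "card I") (simp_all add: algebra_simps)
    finally show ?thesis by (simp add: card_A)
  qed
  have QR: "C \<subseteq> R" if "C \<in> Q" for C
    using that component_subset[of C H] component_nonisolated[of C H]
    unfolding Q_def R_def I_def VH by fastforce
  have Q3: "card C \<ge> 3" if "C \<in> Q" for C using that by (simp add: Q_def)
  have Qdisj: "C \<inter> D = {}" if "C \<in> Q" "D \<in> Q" "C \<noteq> D" for C D
    using that components_disjoint[of C H D] by (simp add: Q_def)
  have finQ: "finite Q"
    using QR finR by (intro finite_subset[of Q "Pow R"]) auto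
  have room: "card R \<ge> 3 * card Q"
  proof -
    have "3 * card Q \<le> (\<Sum>C\<in>Q. card C)" using sum_mono[of Q "\<lambda>_. 3" card] Q3 by simp
    also have "\<dots> = card (\<Union> Q)"
      using Qdisj finite_subset[OF QR finR]
      by (intro card_Union_disjoint[symmetric]) (auto simp: pairwise_def disjnt_def)
    also have "\<dots> \<le> card R" using QR finR by (intro card_mono) auto
    finally show ?thesis .
  qed
  have lower': "card A + 3 * (card R - 3) \<le> card (non_edges G)" if Q2: "card Q \<ge> 2"
  proof -
    obtain C D where CD: "C \<in> Q" "D \<in> Q" "C \<noteq> D"
    proof -
      have "\<not> card Q \<le> Suc 0" using Q2 by simp
      then show thesis using that unfolding card_le_Suc0_iff_eq[OF finQ] by blast
    qed
    \<comment> \<open>Pairs leaving the component \<open>C\<close> inside \<open>R\<close> are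
      further non-edges, disjoint from \<open>A\<close> because they avoid \<open>I\<close>. The
      second component \<open>D\<close> only ensures that \<open>R - C\<close> has at least 3
      elements.\<close>
    define B where "B = {{u, v} | u v. u \<in> C \<and> v \<in> R - C}"
    have finC: "finite C" using QR[OF CD(1)] finR finite_subset by blast
    have "D \<subseteq> R - C" using QR[OF CD(2)] Qdisj[OF CD] by auto
    then have "card (R - C) \<ge> 3" using Q3[OF CD(2)] card_mono[of "R - C" D] finR by force
    moreover have "card C + card (R - C) = card R"
      using QR[OF CD(1)] finC finR by (simp add: card_Diff_subset card_mono)
    ultimately have "3 * (card R - 3) \<le> card B"
      unfolding B_def using card_cross_pairs[of C "R - C"] finC finR
        rectangle_ge[OF Q3[OF CD(1)], of "card (R - C)"] by simp
    moreover have "B \<subseteq> non_edges G"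
    proof
      fix e assume "e \<in> B"
      then obtain u v where e: "e = {u, v}" "u \<in> C" "v \<in> R" "v \<notin> C" by (auto simp: B_def)
      have uv: "u \<in> W" "v \<in> W" using e QR[OF CD(1)] by (auto simp: R_def)
      have "e \<notin> edges H"
        using component_closed[of C H u v] e CD(1) uv by (auto simp: Q_def VH)
      then show "e \<in> non_edges G"
        using e uv unfolding non_edges_def EH W_def by (auto simp: card_2_iff)
    qed
    moreover have "A \<inter> B = {}"
      using QR[OF CD(1)] unfolding A_def B_def R_def by blast
    moreover have "finite (non_edges G)" using finite_non_edges[OF fin] .
    ultimately show ?thesis
      using A_sub card_Un_disjoint[of A B] card_mono[of "non_edges G" "A \<union> B"]
        finite_subset[of A "non_edges G"] finite_subset[of B "non_edges G"] by simp
  qed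
  have A_le: "card A \<le> card (non_edges G)"
    using A_sub finite_non_edges[OF fin] card_mono by blast
  have finS: "finite S" using S fin finite_subset by blast
  have W_card: "card W = card I + card R"
    unfolding R_def using IW finW finite_subset[OF IW finW] by (simp add: card_Diff_subset card_mono)
  have V_card: "card (verts G) = card S + card W"
    unfolding W_def using S finS fin by (simp add: card_Diff_subset card_mono)
  have "card S \<ge> 1" using S finS by (simp add: Suc_leI card_gt_0_iff)
  moreover have "int (card Q) + int k * int (card I) - int k * int (card S) \<ge> 1"
    using deficit by (simp add: deficit_def odd_comps_def isolated_count_def Q_def I_def H_def)
  ultimately have concl: "2 * int (card (non_edges G)) =
        int (card I) * (int (card I) - 1) + 2 * (int (card I) * int (card R)) \<and>
      (int (card I) = 1 \<and> int (card S) = 1 \<or> int (card R) = 0 \<and> int (card I) = 2 \<and> int (card S) = 1 \<or>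
       int (card R) = 0 \<and> int (card I) = 3 \<and> int (card S) = 2)"
  proof (intro deficit_arith)
    show "2 * int (card (non_edges G)) \<ge>
        int (card I) * (int (card I) - 1) + 2 * (int (card I) * int (card R)) + 6 * (int (card R) - 3)"
      if "int (card Q) \<ge> 2"
      using lower' that unfolding A2[symmetric] by simp
    show "2 * int (card (non_edges G)) \<ge>
        int (card I) * (int (card I) - 1) + 2 * (int (card I) * int (card R))"
      using A_le unfolding A2[symmetric] by simp
  qed (use k few V_card W_card room in simp_all)
  \<comment> \<open>Equality of the counts upgrades \<open>A_sub\<close> to equality of
    sets.\<close>
  then have "card A = card (non_edges G)" using A2 by linarith
  then have eq: "non_edges G = A"
    using A_sub finite_non_edges[OF fin] card_subset_eq by metis
  have "I = W" if "card R = 0"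
    using that finR IW by (auto simp: R_def)
  then show thesis
    using that[of I] concl eq IW unfolding A_def W_def by auto
qed

section \<open>Recovering the graph from its non-edges\<close>

lemma edge_iff_not_non_edge:
  assumes "simple_graph G" "u \<in> verts G" "w \<in> verts G"
  shows "{u, w} \<in> edges G \<longleftrightarrow> u \<noteq> w \<and> {u, w} \<notin> non_edges G"
proof -
  have "card {u, w} = 2" if "{u, w} \<in> edges G" using assms that unfolding simple_graph_def by blast
  then show ?thesis using assms unfolding non_edges_def by auto
qed

text \<open>The known set of non-edges fixes adjacency: \<open>card S = 1\<close> leads to the join
  with a pendant vertex, \<open>card S = 2\<close> to the exception of order 5.\<close>

lemma not_GFC_exceptions:
  fixes G :: "'a ugraph"
  assumes n: "n \<ge> 3" "odd n" and k: "k \<ge> 3"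
    and G: "simple_graph G" "connected_graph G" "order G = n"
    and size: "size_e G \<ge> ((n - 1) choose 2) + 1" and not: "\<not> GFC k G"
  shows "G \<simeq> graph_join (complete_graph 1) (graph_union (complete_graph (n - 2)) (complete_graph 1))
    \<or> n = 5 \<and> G \<simeq> graph_join (complete_graph 2) (isolated_graph 3)"
proof -
  have fin: "finite (verts G)" and nV: "card (verts G) = n"
    using G by (auto simp: simple_graph_def order_def)
  have "deficit k G {} = 1" using deficit_empty[of G k] G(2) n nV by simp
  then obtain S where S: "S \<subseteq> verts G" "S \<noteq> {}" "deficit k G S \<ge> 1"
    using positive_deficit_if_not_GFC[OF fin _ _ not] G n by blast
  \<comment> \<open>Pascal's rule gives \<open>n choose 2 = (m choose 2) + m\<close>, so the edge
    bound leaves at most \<open>m - 1 = n - 2\<close> non-edges.\<close>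
  obtain m where m: "n = Suc m" using n by (cases n) auto
  have "card (non_edges G) + 2 \<le> card (verts G)"
    using card_non_edges[OF G(1)] size unfolding G(3) nV m by (simp add: numeral_2_eq_2)
  from positive_deficit_structure[OF G(1) S(1,2) k S(3) this]
  obtain I where I: "I \<subseteq> verts G - S"
    and ne: "non_edges G = {e. e \<subseteq> verts G - S \<and> card e = 2 \<and> e \<inter> I \<noteq> {}}"
    and cases: "card I = 1 \<and> card S = 1 \<or>
     I = verts G - S \<and> (card I = 2 \<and> card S = 1 \<or> card I = 3 \<and> card S = 2)" .
  have E: "{u, w} \<in> edges G \<longleftrightarrow> u \<noteq> w \<and> (u \<in> S \<or> w \<in> S \<or> (u \<notin> I \<and> w \<notin> I))"
    if "u \<in> verts G" "w \<in> verts G" for u w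
    using that unfolding edge_iff_not_non_edge[OF G(1) that] ne by auto
  show ?thesis
  proof (cases "card S = 1")
    case True
    then obtain x where x: "S = {x}" by (auto simp: card_1_singleton_iff)
    have "I \<noteq> {}" using cases by auto
    then obtain v where v: "v \<in> I" by blast
    have "{u, w} \<in> edges G \<longleftrightarrow> u \<noteq> w \<and> (u = x \<or> w = x \<or> (u \<noteq> v \<and> w \<noteq> v))"
      if uw: "u \<in> verts G" "w \<in> verts G" for u w
    proof -
      \<comment> \<open>In the second case \<open>G\<close> is the path on \<open>v\<close>,
        \<open>x\<close>, \<open>v'\<close>. It is the same exception with \<open>n = 3\<close>,
        where \<open>v'\<close> forms the clique on \<open>n - 2 = 1\<close> vertices.\<close>
      consider "I = {v}" | v' where "I = {v, v'}" "I = verts G - S"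
      proof -
        have "\<exists>v'. I = {v, v'}" if "card I = 2"
          using that v by (auto simp: card_2_iff)
        then show thesis using that cases v True by (auto simp: card_1_singleton_iff)
      qed
      then show ?thesis
      proof cases
        case 2
        then have "u = x \<or> u = v \<or> u = v'" "w = x \<or> w = v \<or> w = v'"
          "x \<noteq> v" "x \<noteq> v'"
          using uw x by auto
        then show ?thesis using E[OF uw] x 2(1) by auto
      qed (use E[OF uw] x in auto)
    qed
    then have "G \<simeq> graph_join (complete_graph 1) (graph_union (complete_graph (n - 2)) (complete_graph 1))"
      using graph_iso_join_pendant[OF fin nV, of x v] x v S(1) I by blast
    then show ?thesis ..
  next
    case False
    then have F: "I = verts G - S" "card (verts G - S) = 3" "card S = 2" using cases by auto
    have "n = 5"
      using F S(1) fin nV card_Diff_subset[of S "verts G"] finite_subset[of S] by auto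
    moreover have "G \<simeq> graph_join (complete_graph 2) (isolated_graph 3)"
      using F E by (intro graph_iso_join_isolated[OF fin S(1)]) auto
    ultimately show ?thesis by blast
  qed
qed

theorem theorem3p1:
  fixes G :: "'a ugraph" and n k :: nat
  assumes "n \<ge> 3" and "odd n" and "k \<ge> 3" and "odd k"
    and "simple_graph G" and "connected_graph G" and "order G = n"
  shows "((n \<ge> 7 \<or> n = 3) \<and> size_e G \<ge> ((n - 1) choose 2) + 1 \<longrightarrow>
           \<not> G \<simeq> graph_join (complete_graph 1) (graph_union (complete_graph (n - 2)) (complete_graph 1)) \<longrightarrow>
           GFC k G)
       \<and> (n = 5 \<and> size_e G \<ge> 7 \<longrightarrow>
           \<not> (G \<simeq> graph_join (complete_graph 1) (graph_union (complete_graph 3) (complete_graph 1))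
              \<or> G \<simeq> graph_join (complete_graph 2) (isolated_graph 3)) \<longrightarrow>
           GFC k G)"
proof -
  \<comment> \<open>For \<open>n = 5\<close> the common bound \<open>((n - 1) choose 2) + 1\<close>
    is exactly 7, so one lemma serves both parts.\<close>
  have four: "(4::nat) choose 2 = 6" by (simp add: choose_two)
  show ?thesis
  proof (cases "GFC k G")
    case False
    then show ?thesis using not_GFC_exceptions[OF assms(1-3,5-7)] four by auto
  qed simp
qed

end
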